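(* Let $\lambda$ be a nonzero real number, let $Y_1,Y_2,\dots$ be independent random variables each uniformly distributed on $[0,1]$, and let $Y^{(m)}=Y_1+\cdots+Y_m$ for $m\ge1$, $Y^{(0)}=0$. Then for all integers $m,n\ge0$, \[ S_{n,\lambda}^{Y^{(m)}}(x)=\sum_{k=0}^{n}\frac{\binom{n}{k}}{\binom{n-k+m}{m}}\,\lambda^{n-k}\,S_{1}(n-k+m,m)\,\beta_{k,\lambda}^{(m)}(x). \]
   Context: For a nonzero real $\lambda$ and any $x$, set $(x)_{0,\lambda}=1$ and $(x)_{n,\lambda}=x(x-\lambda)\cdots(x-(n-1)\lambda)$ for $n\ge1$, $e_{\lambda}^{x}(t)=\sum_{k\ge0}(x)_{k,\lambda}\frac{t^k}{k!}=(1+\lambda t)^{x/\lambda}$, $e_\lambda(t)=e_\lambda^1(t)$. Higher-order degenerate Bernoulli polynomials: $\left(\frac{t}{e_\lambda(t)-1}\right)^{m}e_\lambda^x(t)=\sum_{n\ge0}\beta_{n,\lambda}^{(m)}(x)\frac{t^n}{n!}$. The Stirling numbers of the first kind $S_1(n,k)$ are defined by $\frac{1}{k!}\log^k(1+t)=\sum_{n\ge k}S_1(n,k)\frac{t^n}{n!}$. For a random variable $Z$ whose moment generating function exists near $0$, the degenerate Sheffer polynomials associated with $Z$ are defined by $\frac{1}{E[e_\lambda^{Z}(t)]}\,e_\lambda^x(t)=\sum_{n\ge0}S_{n,\lambda}^{Z}(x)\frac{t^n}{n!}$, where $E[e_\lambda^Z(t)]=E[(1+\lambda t)^{Z/\lambda}]$.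 *)

theory Defs
  imports "HOL-Probability.Probability"
begin

definition degen_falling :: "real \<Rightarrow> real \<Rightarrow> nat \<Rightarrow> real" where
  "degen_falling lam x n = (\<Prod>i<n. x - real i * lam)"

definition degen_exp :: "real \<Rightarrow> real \<Rightarrow> real fps" where
  "degen_exp lam x = Abs_fps (\<lambda>k. degen_falling lam x k / fact k)"

text \<open>
  For \<open>lam \<noteq> 0\<close>, the formal series is the expansion at 0 of \<open>(1 + lam * t) powr (x / lam)\<close>.
\<close>

lemma has_fps_expansion_degen_exp:
  assumes "lam \<noteq> 0"
  shows "(\<lambda>t. (1 + lam * t) powr (x / lam)) has_fps_expansion degen_exp lam x"
proof -
  have coeff: "degen_falling lam x k / fact k = (x / lam gchoose k) * lam ^ k" for k
  proof -
    have "(x / lam gchoose k) * lam ^ k = (\<Prod>i<k. (x / lam - real i) * lam) / fact k"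
      by (simp add: gbinomial_prod_rev prod.distrib atLeast0LessThan)
    also have "(\<Prod>i<k. (x / lam - real i) * lam) = degen_falling lam x k"
      unfolding degen_falling_def using assms
      by (intro prod.cong) (auto simp: field_simps)
    finally show ?thesis by simp
  qed
  have sums: "(\<lambda>k. fps_nth (degen_exp lam x) k * t ^ k) sums (1 + lam * t) powr (x / lam)"
    if "t \<in> ball 0 (1 / \<bar>lam\<bar>)" for t
    using gen_binomial_real[of "lam * t" "x / lam"] that assms
    by (simp add: degen_exp_def coeff power_mult_distrib abs_mult field_simps)
  have "\<forall>\<^sub>F t in nhds 0. t \<in> ball 0 (1 / \<bar>lam\<bar>)"
    using assms by (intro eventually_nhds_in_open) auto
  then show ?thesis
    by (intro has_fps_expansionI) (rule eventually_mono[OF _ sums])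
qed

definition degen_bernoulli :: "real \<Rightarrow> nat \<Rightarrow> nat \<Rightarrow> real \<Rightarrow> real" where
  "degen_bernoulli lam m n x =
     fact n * fps_nth ((fps_X / (degen_exp lam 1 - 1)) ^ m * degen_exp lam x) n"

text \<open>
  The signed Stirling numbers of the first kind; \<open>fps_ln 1\<close> is the series of \<open>log (1 + t)\<close>.
\<close>

definition stirling1 :: "nat \<Rightarrow> nat \<Rightarrow> real" where
  "stirling1 n k = fact n * fps_nth (fps_const (1 / fact k) * fps_ln 1 ^ k) n"

text \<open>
  The generating function is read as a genuine function of the real variable \<open>t\<close> near 0, with
  the expectation taken pointwise in \<open>t\<close>. Its power series expansion is unique if it exists, which
  it does when \<open>lam \<noteq> 0\<close> and the moment generating function of \<open>Z\<close> exists near 0.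
\<close>

definition degen_sheffer :: "'a measure \<Rightarrow> real \<Rightarrow> ('a \<Rightarrow> real) \<Rightarrow> nat \<Rightarrow> real \<Rightarrow> real" where
  "degen_sheffer M lam Z n x =
     fact n * fps_nth (THE F.
       (\<lambda>t. 1 / (\<integral>\<omega>. (1 + lam * t) powr (Z \<omega> / lam) \<partial>M) * (1 + lam * t) powr (x / lam))
         has_fps_expansion F) n"

lemma has_fps_expansion_unique_real:
  fixes F G :: "real fps"
  assumes "f has_fps_expansion F" "f has_fps_expansion G"
  shows "F = G"
proof (rule ccontr)
  define H where "H = F - G"
  define k where "k = subdegree H"
  assume "F \<noteq> G"
  then have "H \<noteq> 0"
    by (simp add: H_def)
  then have k: "fps_nth H k \<noteq> 0"
    by (simp add: k_def)
  have "(\<lambda>t. f t - f t) has_fps_expansion H"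
    unfolding H_def using assms by (intro has_fps_expansion_diff)
  then have H: "fps_conv_radius H > 0" "\<forall>\<^sub>F t in nhds 0. eval_fps H t = 0"
    by (simp_all add: has_fps_expansion_def)
  have "\<forall>\<^sub>F t in nhds 0. t \<in> eball (0 :: real) (fps_conv_radius H)"
    using H(1) by (intro eventually_nhds_in_open) (auto simp: zero_ereal_def)
  with H(2) have "\<forall>\<^sub>F t in nhds 0. t \<noteq> 0 \<longrightarrow> eval_fps (fps_shift k H) t = 0"
    by eventually_elim (auto simp: eval_fps_shift k_def)
  then have "\<forall>\<^sub>F t in at 0. eval_fps (fps_shift k H) t = 0"
    by (simp add: eventually_at_filter)
  then have "(eval_fps (fps_shift k H) \<longlongrightarrow> 0) (at 0)"
    by (rule tendsto_eventually)
  moreover have "isCont (eval_fps (fps_shift k H)) 0"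
    using H(1) by (intro continuous_eval_fps) (auto simp: zero_ereal_def)
  then have "(eval_fps (fps_shift k H) \<longlongrightarrow> fps_nth H k) (at 0)"
    by (simp add: isCont_def eval_fps_at_0)
  ultimately show False
    using k by (auto dest: tendsto_unique[rotated])
qed

lemma degen_sheffer_eqI:
  assumes "(\<lambda>t. 1 / (\<integral>\<omega>. (1 + lam * t) powr (Z \<omega> / lam) \<partial>M) * (1 + lam * t) powr (x / lam))
             has_fps_expansion F"
  shows "degen_sheffer M lam Z n x = fact n * fps_nth F n"
proof -
  have "(THE F. (\<lambda>t. 1 / (\<integral>\<omega>. (1 + lam * t) powr (Z \<omega> / lam) \<partial>M) * (1 + lam * t) powr (x / lam))
          has_fps_expansion F) = F"
    using assms by (intro the_equality) (auto dest: has_fps_expansion_unique_real)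
  then show ?thesis
    by (simp add: degen_sheffer_def)
qed

end

theory Submission
  imports Defs "HOL-Complex_Analysis.Laurent_Convergence"
begin

text \<open>
  For a single uniform variable the expectation of \<open>(1 + lam * t) powr (Y / lam)\<close> is
  \<open>((1 + lam * t) powr (1 / lam) - 1) * lam / ln (1 + lam * t)\<close>, and by independence the one
  for the sum is its \<open>m\<close>-th power. Its reciprocal splits into the \<open>m\<close>-th powers of
  \<open>t / ((1 + lam * t) powr (1 / lam) - 1)\<close>, which produces the Bernoulli polynomials, and of
  \<open>ln (1 + lam * t) / (lam * t)\<close>, which produces the Stirling numbers; the claim is their
  Cauchy product.
\<close>

text \<open>The interval has length 1, so no normalising factor remains; in density form, integrals
  against the law become Lebesgue integrals over \<open>{0..1}\<close>.\<close>

lemma uniform_measure_unit_interval: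
  "uniform_measure lborel {0..1::real} = density lborel (\<lambda>u. ennreal (indicator {0..1} u))"
  by (simp add: uniform_measure_def divide_ennreal_def ennreal_indicator)

lemma integrable_uniform_unit_interval:
  fixes f :: "real \<Rightarrow> real"
  assumes "continuous_on {0..1} f" "f \<in> borel_measurable borel"
  shows "integrable (uniform_measure lborel {0..1}) f"
proof -
  have "integrable lborel (\<lambda>u. indicator {0..1} u *\<^sub>R f u)"
    using borel_integrable_atLeastAtMost'[OF assms(1)] by (simp add: set_integrable_def)
  then show ?thesis
    unfolding uniform_measure_unit_interval using assms(2) by (subst integrable_density) auto
qed

lemma integral_uniform_unit_interval:
  fixes f F :: "real \<Rightarrow> real"
  assumes "continuous_on {0..1} f" "f \<in> borel_measurable borel"
    and "\<And>u. (F has_real_derivative f u) (at u)"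
  shows "(\<integral>u. f u \<partial>uniform_measure lborel {0..1}) = F 1 - F 0"
proof -
  have "(\<integral>u. f u \<partial>uniform_measure lborel {0..1}) = (\<integral>u. indicator {0..1} u *\<^sub>R f u \<partial>lborel)"
    unfolding uniform_measure_unit_interval using assms(2) by (subst integral_density) auto
  also have "\<dots> = F 1 - F 0"
    using assms(1,3)
    by (intro integral_FTC_atLeastAtMost)
       (auto simp flip: has_real_derivative_iff_has_vector_derivative intro: DERIV_subset)
  finally show ?thesis .
qed

text \<open>An antiderivative in \<open>u\<close> is \<open>b powr (u / c) * c / ln b\<close>. For
  \<open>b = 1\<close> the logarithm vanishes, so the point \<open>t = 0\<close> is treated
  separately later.\<close>

lemma integral_powr_uniform_unit_interval:
  fixes b c :: real
  assumes "b > 0" "b \<noteq> 1" "c \<noteq> 0"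
  shows "(\<integral>u. b powr (u / c) \<partial>uniform_measure lborel {0..1}) = (b powr (1 / c) - 1) * c / ln b"
proof -
  have "((\<lambda>u. b powr (u / c) * c / ln b) has_real_derivative b powr (u / c)) (at u)" for u
    using assms by (auto intro!: derivative_eq_intros)
  moreover have "continuous_on {0..1} (\<lambda>u. b powr (u / c))"
    using assms by (auto intro!: continuous_intros)
  ultimately show ?thesis
    using assms by (subst integral_uniform_unit_interval) (auto simp: field_simps)
qed

lemma (in prob_space) expectation_powr_sum_uniform:
  fixes Y :: "nat \<Rightarrow> 'a \<Rightarrow> real"
  assumes indep: "indep_vars (\<lambda>_. borel) Y {1..}"
    and unif: "\<And>i. i \<ge> 1 \<Longrightarrow> distr M borel (Y i) = uniform_measure lborel {0..1}"
    and b: "b > 0" and c: "c \<noteq> 0"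
  shows "expectation (\<lambda>\<omega>. b powr ((\<Sum>i=1..m. Y i \<omega>) / c)) =
    (\<integral>u. b powr (u / c) \<partial>uniform_measure lborel {0..1}) ^ m"
proof -
  let ?f = "\<lambda>u. b powr (u / c)"
  have f[measurable]: "?f \<in> borel_measurable borel" by simp
  have rv: "Y i \<in> borel_measurable M" if "i \<in> {1..m}" for i
    using indep that unfolding indep_vars_def by auto
  \<comment> \<open>Integrability is checked on the law of \<open>Y i\<close>, where the integrand
    is continuous on a compact interval.\<close>
  have int: "integrable M (\<lambda>\<omega>. ?f (Y i \<omega>))" if "i \<in> {1..m}" for i
  proof -
    have "integrable (distr M borel (Y i)) ?f"
      using that b c by (subst unif) (auto intro!: integrable_uniform_unit_interval continuous_intros)
    then show ?thesis
      using integrable_distr_eq[OF rv[OF that] f] by simp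
  qed
  have ind: "indep_vars (\<lambda>_. borel) (\<lambda>i \<omega>. ?f (Y i \<omega>)) {1..m}"
    by (rule indep_vars_compose2[OF indep_vars_subset[OF indep]]) auto
  have "?f (\<Sum>i=1..m. Y i \<omega>) = (\<Prod>i\<in>{1..m}. ?f (Y i \<omega>))" for \<omega>
    using b by (simp add: sum_divide_distrib powr_sum)
  then have "expectation (\<lambda>\<omega>. ?f (\<Sum>i=1..m. Y i \<omega>)) = (\<Prod>i\<in>{1..m}. expectation (\<lambda>\<omega>. ?f (Y i \<omega>)))"
    using indep_vars_lebesgue_integral[OF _ ind int] by simp
  also have "\<dots> = (\<Prod>i\<in>{1..m}. \<integral>u. ?f u \<partial>uniform_measure lborel {0..1})"
  proof (rule prod.cong[OF refl])
    fix i assume i: "i \<in> {1..m}"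
    then show "expectation (\<lambda>\<omega>. ?f (Y i \<omega>)) = (\<integral>u. ?f u \<partial>uniform_measure lborel {0..1})"
      using integral_distr[OF rv[OF i] f] unif[of i] by simp
  qed
  finally show ?thesis by simp
qed

lemma has_fps_expansion_ln_linear:
  fixes c :: real
  shows "(\<lambda>t. ln (1 + c * t)) has_fps_expansion (fps_ln 1 oo (fps_const c * fps_X))"
proof -
  have "(\<lambda>k. fps_nth (fps_ln 1 oo (fps_const c * fps_X)) k * t ^ k) sums ln (1 + c * t)"
    if "\<bar>c * t\<bar> < 1" for t
  proof -
    \<comment> \<open>At \<open>k = 0\<close> the right-hand side is a division by zero, hence 0,
      which agrees with the vanishing constant coefficient of the logarithm.\<close>
    have "fps_nth (fps_ln 1 oo (fps_const c * fps_X)) k * t ^ k = - ((- (c * t)) ^ k) / of_nat k" for k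
      unfolding fps_nth_compose_linear fps_ln_nth power_minus[of "c * t"]
      by (cases k) (simp_all add: power_mult_distrib)
    with ln_series'[OF that] show ?thesis by simp
  qed
  moreover have "\<forall>\<^sub>F t in nhds 0. \<bar>c * t\<bar> < 1"
    by (rule eventually_nhds_in_open[of "{t. \<bar>c * t\<bar> < 1}", simplified])
       (auto intro!: open_Collect_less continuous_intros)
  ultimately show ?thesis
    by (intro has_fps_expansionI) (auto elim!: eventually_mono)
qed

lemma fps_nth_fps_ln_power:
  "fps_nth (fps_ln 1 ^ m) n = fact m / fact n * stirling1 n m"
  by (simp add: stirling1_def)

text \<open>The logarithm series has no constant term, so it is its shift times
  \<open>fps_X\<close>, and coefficient \<open>j\<close> of the shifted power is coefficient
  \<open>j + m\<close> of the unshifted one. The linear substitution scales that coefficient by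
  \<open>c ^ (j + m)\<close>.\<close>

lemma fps_nth_shift_fps_ln_linear_power:
  "fps_nth (fps_shift 1 (fps_ln 1 oo (fps_const c * fps_X)) ^ m) j =
     c ^ (j + m) * (fact m / fact (j + m) * stirling1 (j + m) m)"
proof -
  let ?L = "fps_ln 1 oo (fps_const c * fps_X) :: real fps"
  have "fps_shift 1 ?L * fps_X = ?L"
    by (rule fps_ext) auto
  then have "?L ^ m = fps_shift 1 ?L ^ m * fps_X ^ m"
    by (metis power_mult_distrib)
  then have "fps_nth (fps_shift 1 ?L ^ m) j = fps_nth (?L ^ m) (j + m)"
    by (simp add: fps_X_power_mult_right_nth)
  also have "?L ^ m = fps_ln 1 ^ m oo (fps_const c * fps_X)"
    by (simp add: fps_compose_power)
  finally show ?thesis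
    by (simp add: fps_nth_fps_ln_power)
qed

lemma subdegree_degen_exp_minus_1: "subdegree (degen_exp lam 1 - 1) = 1"
  by (rule subdegreeI) (auto simp: degen_exp_def degen_falling_def)

text \<open>The denominator has a simple zero at 0 with linear coefficient 1, so the singularity is
  removable with value 1.\<close>

lemma has_fps_expansion_bernoulli_kernel:
  assumes "lam \<noteq> 0"
  shows "(\<lambda>t. if t = 0 then 1 else t / ((1 + lam * t) powr (1 / lam) - 1))
    has_fps_expansion fps_X / (degen_exp lam 1 - 1)"
  using assms subdegree_degen_exp_minus_1[of lam]
  by (intro has_fps_expansion_divide has_fps_expansion_fps_X has_fps_expansion_diff
        has_fps_expansion_degen_exp has_fps_expansion_1)
     (auto simp: degen_exp_def degen_falling_def)

lemma has_fps_expansion_ln_kernel: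
  fixes lam :: real
  assumes "lam \<noteq> 0"
  shows "(\<lambda>t. if t = 0 then lam else ln (1 + lam * t) / t)
    has_fps_expansion fps_shift 1 (fps_ln 1 oo (fps_const lam * fps_X))"
proof -
  let ?L = "fps_ln 1 oo (fps_const lam * fps_X) :: real fps"
  have "fps_nth ?L 0 = 0" "fps_nth ?L 1 = lam"
    by (simp_all add: fps_ln_nth)
  then have "subdegree ?L = 1"
    using assms by (intro subdegreeI) auto
  then show ?thesis
    using has_fps_expansion_shift[OF has_fps_expansion_ln_linear, of 1 lam lam]
    by (simp add: fps_ln_nth cong: if_cong)
qed

theorem theorem3p5:
  fixes M :: "'a measure" and Y :: "nat \<Rightarrow> 'a \<Rightarrow> real" and lam x :: real and m n :: nat
  assumes "prob_space M"
    and "lam \<noteq> 0"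
    and "prob_space.indep_vars M (\<lambda>_. borel) Y {1..}"
    and "\<And>i. i \<ge> 1 \<Longrightarrow> distr M borel (Y i) = uniform_measure lborel {0..1}"
  shows "degen_sheffer M lam (\<lambda>\<omega>. \<Sum>i=1..m. Y i \<omega>) n x =
    (\<Sum>k=0..n. real (n choose k) / real ((n - k + m) choose m) * lam ^ (n - k) *
       stirling1 (n - k + m) m * degen_bernoulli lam m k x)"
proof -
  interpret prob_space M by fact
  interpret U: prob_space "uniform_measure lborel {0..1::real}"
    by (intro prob_space_uniform_measure) auto
  define W where "W = fps_X / (degen_exp lam 1 - 1)"
  define V where "V = fps_shift 1 (fps_ln 1 oo (fps_const lam * fps_X))"
  define w where "w t = (if t = 0 then 1 else t / ((1 + lam * t) powr (1 / lam) - 1))" for t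
  define v where "v t = (if t = 0 then lam else ln (1 + lam * t) / t)" for t
  \<comment> \<open>Since the expectation will be \<open>(lam / (w t * v t)) ^ m\<close>, its
    reciprocal contributes \<open>W ^ m * V ^ m\<close> and the constant
    \<open>1 / lam ^ m\<close>.\<close>
  define F where "F = (W ^ m * degen_exp lam x) * (fps_const (1 / lam ^ m) * V ^ m)"
  have w: "w has_fps_expansion W"
    unfolding w_def W_def by (rule has_fps_expansion_bernoulli_kernel[OF assms(2)])
  have v: "v has_fps_expansion V"
    unfolding v_def V_def by (rule has_fps_expansion_ln_kernel[OF assms(2)])
  have E: "(\<integral>\<omega>. (1 + lam * t) powr ((\<Sum>i=1..m. Y i \<omega>) / lam) \<partial>M) = (lam / (w t * v t)) ^ m"
    if "1 + lam * t > 0" for t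
  proof -
    have "(\<integral>u. (1 + lam * t) powr (u / lam) \<partial>uniform_measure lborel {0..1}) = lam / (w t * v t)"
    \<comment> \<open>At \<open>t = 0\<close> the integrand is 1 and the total mass is 1, matching
      \<open>w 0 * v 0 = lam\<close>; elsewhere the factors \<open>t\<close> in \<open>w t\<close>
      and \<open>v t\<close> cancel.\<close>
    proof (cases "t = 0")
      case True
      then show ?thesis using assms(2) U.prob_space by (simp add: w_def v_def)
    next
      case False
      then show ?thesis
        using integral_powr_uniform_unit_interval[OF that _ assms(2)] assms(2)
        by (simp add: w_def v_def field_simps)
    qed
    then show ?thesis
      using expectation_powr_sum_uniform[OF assms(3,4) that assms(2)] by simp
  qed
  \<comment> \<open>An expansion at 0 depends only on values near 0, so it suffices to use
    \<open>E\<close> where the base is positive.\<close>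
  have "\<forall>\<^sub>F t in nhds 0. 1 + lam * t > 0"
    by (rule eventually_nhds_in_open[of "{t. 1 + lam * t > 0}", simplified])
       (auto intro!: open_Collect_less continuous_intros)
  then have "\<forall>\<^sub>F t in nhds 0. (w t ^ m * (1 + lam * t) powr (x / lam)) * (1 / lam ^ m * v t ^ m) =
     1 / (\<integral>\<omega>. (1 + lam * t) powr ((\<Sum>i=1..m. Y i \<omega>) / lam) \<partial>M) * (1 + lam * t) powr (x / lam)"
    by eventually_elim (simp only: E, simp add: power_mult_distrib power_divide)
  moreover have "(\<lambda>t. (w t ^ m * (1 + lam * t) powr (x / lam)) * (1 / lam ^ m * v t ^ m))
      has_fps_expansion F"
    unfolding F_def
    by (intro has_fps_expansion_mult has_fps_expansion_cmult_left has_fps_expansion_power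
          has_fps_expansion_degen_exp w v assms(2))
  ultimately have "(\<lambda>t. 1 / (\<integral>\<omega>. (1 + lam * t) powr ((\<Sum>i=1..m. Y i \<omega>) / lam) \<partial>M) *
      (1 + lam * t) powr (x / lam)) has_fps_expansion F"
    by (rule iffD1[OF has_fps_expansion_cong[OF _ refl]])
  then have "degen_sheffer M lam (\<lambda>\<omega>. \<Sum>i=1..m. Y i \<omega>) n x = fact n * fps_nth F n"
    by (rule degen_sheffer_eqI)
  also have "\<dots> = (\<Sum>k=0..n. fact n * (fps_nth (W ^ m * degen_exp lam x) k *
      (fps_nth (V ^ m) (n - k) / lam ^ m)))"
    unfolding F_def fps_mult_nth[of "W ^ m * degen_exp lam x"] by (simp add: sum_distrib_left)
  also have "\<dots> = (\<Sum>k=0..n. real (n choose k) / real ((n - k + m) choose m) * lam ^ (n - k) *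
       stirling1 (n - k + m) m * degen_bernoulli lam m k x)"
  proof (rule sum.cong[OF refl])
    \<comment> \<open>In the quotient of the two binomials \<open>fact (n - k)\<close> cancels,
      leaving \<open>fact n * fact m / (fact k * fact (n - k + m))\<close>. The surplus
      \<open>lam ^ m\<close> in the coefficient of \<open>V ^ m\<close> cancels against the constant
      in \<open>F\<close>.\<close>
    fix k assume "k \<in> {0..n}"
    then have "real (n choose k) = fact n / (fact k * fact (n - k))"
      by (simp add: binomial_fact)
    moreover have "real ((n - k + m) choose m) = fact (n - k + m) / (fact m * fact (n - k))"
      by (simp add: binomial_fact)
    moreover have "fps_nth (V ^ m) (n - k) =
        lam ^ (n - k) * lam ^ m * (fact m / fact (n - k + m) * stirling1 (n - k + m) m)"
      unfolding V_def fps_nth_shift_fps_ln_linear_power power_add ..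
    moreover have "degen_bernoulli lam m k x = fact k * fps_nth (W ^ m * degen_exp lam x) k"
      by (simp add: degen_bernoulli_def W_def)
    ultimately show "fact n * (fps_nth (W ^ m * degen_exp lam x) k *
        (fps_nth (V ^ m) (n - k) / lam ^ m)) =
      real (n choose k) / real ((n - k + m) choose m) * lam ^ (n - k) *
        stirling1 (n - k + m) m * degen_bernoulli lam m k x"
      using assms(2) by (simp only:) simp
  qed
  finally show ?thesis .
qed

end
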